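(* Let $G$ be a finite simple connected graph, $Y$ a nonempty full subgraph of $G$, and $V_2=V(Y)$. Write $L(G)=\begin{bmatrix} A & B\\ B^{T} & D\end{bmatrix}$ with $A$ indexed by $V(G)\setminus V_2$ and $D$ indexed by $V_2$. Let $S(V_2)$ be the Schur complement graph associated with $V_2$ and $\boldsymbol{w}$ the weight on it induced by $S=D-B^TA^{-1}B$. The following statements are equivalent: (a) $\tau(G) = {\det}'(A)\,\tau(S(V_2),\boldsymbol{w})$. (b) ${\det}'(L(G)) = \dfrac{|V(G)|}{|V(Y)|}\,\det(A)\,{\det}'(\mathrm{DN}(G,Y))$.
   Context: For a square matrix $M$, the pseudo-determinant ${\det}'(M)$ is the product of the non-zero eigenvalues of $M$ (with multiplicity; an empty product is $1$, and the determinant of an empty matrix is $1$). A subgraph $Y$ of $G$ is full if $u,v\in V(Y)$ and $\{u,v\}\in E(G)$ imply $\{u,v\}\in E(Y)$. $L(G)$ is the graph Laplacian: $L(G)(u,u)$ is the degree of $u$, $L(G)(u,v)=-1$ if $\{u,v\}\in E(G)$, and $0$ otherwise. $\tau(G)$ is the number of spanning trees of $G$. The matrix $A$ is invertible, and the Dirichlet-to-Neumann map is $\mathrm{DN}(G,Y)=S=D-B^TA^{-1}B$, a matrix indexed by $V_2=V(Y)$. The Schur complement graph $S(V_2)$ has vertex set $V_2$, and distinct $v,v'\in V_2$ are joined by an edge iff the $(v,v')$ entry of $S$ is non-zero. The weight $\boldsymbol{w}$ induced by $S$ assigns to an edge $\{v,v'\}$ the number $-S_{vv'}$ (so that $S$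 is the weighted Laplacian of $(S(V_2),\boldsymbol{w})$). For a weighted graph $(H,\boldsymbol{w})$, the spanning tree enumerator is $\tau(H,\boldsymbol{w})=\sum_{T}\prod_{\{u,v\}\in E(T)}w_{uv}$, the sum being over all spanning trees $T$ of $H$. *)

theory Defs
  imports Complex_Main "Jordan_Normal_Form.Char_Poly"
    "Jordan_Normal_Form.Gauss_Jordan_Elimination"
begin

record 'a graph =
  verts :: "'a set"
  edges :: "'a set set"

definition finite_simple_graph :: "'a graph \<Rightarrow> bool" where
  "finite_simple_graph G \<longleftrightarrow> finite (verts G) \<and>
     (\<forall>e\<in>edges G. \<exists>u\<in>verts G. \<exists>v\<in>verts G. u \<noteq> v \<and> e = {u, v})"

definition connected_graph :: "'a graph \<Rightarrow> bool" where
  "connected_graph G \<longleftrightarrow> verts G \<noteq> {} \<and>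
     (\<forall>u\<in>verts G. \<forall>v\<in>verts G. (u, v) \<in> {(x, y). {x, y} \<in> edges G}\<^sup>*)"

definition is_cycle :: "'a graph \<Rightarrow> 'a list \<Rightarrow> bool" where
  "is_cycle G vs \<longleftrightarrow> 3 \<le> length vs \<and> distinct vs \<and>
     (\<forall>i<length vs. {vs ! i, vs ! (Suc i mod length vs)} \<in> edges G)"

definition is_tree :: "'a graph \<Rightarrow> bool" where
  "is_tree T \<longleftrightarrow> finite_simple_graph T \<and> connected_graph T \<and> (\<nexists>vs. is_cycle T vs)"

definition is_subgraph :: "'a graph \<Rightarrow> 'a graph \<Rightarrow> bool" where
  "is_subgraph Y G \<longleftrightarrow>
     finite_simple_graph Y \<and> verts Y \<subseteq> verts G \<and> edges Y \<subseteq> edges G"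

definition full_subgraph :: "'a graph \<Rightarrow> 'a graph \<Rightarrow> bool" where
  "full_subgraph Y G \<longleftrightarrow> is_subgraph Y G \<and>
     (\<forall>u\<in>verts Y. \<forall>v\<in>verts Y. {u, v} \<in> edges G \<longrightarrow> {u, v} \<in> edges Y)"

definition spanning_trees :: "'a graph \<Rightarrow> 'a graph set" where
  "spanning_trees G = {T. is_subgraph T G \<and> verts T = verts G \<and> is_tree T}"

definition num_spanning_trees :: "'a graph \<Rightarrow> nat" where
  "num_spanning_trees G = card (spanning_trees G)"

definition spanning_tree_enumerator :: "'a graph \<Rightarrow> ('a set \<Rightarrow> real) \<Rightarrow> real" where
  "spanning_tree_enumerator H w = (\<Sum>T\<in>spanning_trees H. \<Prod>e\<in>edges T. w e)"

definition degree_of :: "'a graph \<Rightarrow> 'a \<Rightarrow> nat" where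
  "degree_of G u = card {v \<in> verts G. {u, v} \<in> edges G}"

definition laplacian :: "'a graph \<Rightarrow> 'a \<Rightarrow> 'a \<Rightarrow> real" where
  "laplacian G u v =
     (if u = v then real (degree_of G u) else if {u, v} \<in> edges G then -1 else 0)"

text \<open>
  Matrices with rows and columns indexed by vertices become \<open>nat\<close>-indexed through
  lists enumerating the index sets: row \<open>i\<close> belongs to the vertex \<open>us ! i\<close> and
  column \<open>j\<close> to \<open>ws ! j\<close>.
\<close>

definition laplacian_block :: "'a graph \<Rightarrow> 'a list \<Rightarrow> 'a list \<Rightarrow> real mat" where
  "laplacian_block G us ws =
     mat (length us) (length ws) (\<lambda>(i, j). laplacian G (us ! i) (ws ! j))"

abbreviation laplacian_matrix :: "'a graph \<Rightarrow> 'a list \<Rightarrow> real mat" where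
  "laplacian_matrix G vs \<equiv> laplacian_block G vs vs"

text \<open>Only meaningful for invertible \<open>A\<close>: otherwise \<open>mat_inverse A\<close> is \<open>None\<close>.\<close>

definition schur_complement :: "real mat \<Rightarrow> real mat \<Rightarrow> real mat \<Rightarrow> real mat" where
  "schur_complement A B D = D - transpose_mat B * the (mat_inverse A) * B"

text \<open>
  The Dirichlet-to-Neumann map of \<open>G\<close> and \<open>Y\<close>, where \<open>us\<close> enumerates the vertices of
  \<open>G\<close> outside \<open>Y\<close> and \<open>ws\<close> those of \<open>Y\<close>.
\<close>

definition dirichlet_to_neumann :: "'a graph \<Rightarrow> 'a list \<Rightarrow> 'a list \<Rightarrow> real mat" where
  "dirichlet_to_neumann G us ws =
     schur_complement (laplacian_block G us us) (laplacian_block G us ws)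
       (laplacian_block G ws ws)"

definition schur_graph :: "'a list \<Rightarrow> real mat \<Rightarrow> 'a graph" where
  "schur_graph ws S =
     \<lparr>verts = set ws,
      edges = {{ws ! i, ws ! j} | i j.
        i < length ws \<and> j < length ws \<and> i \<noteq> j \<and> S $$ (i, j) \<noteq> 0}\<rparr>"

text \<open>
  Well defined when \<open>ws\<close> is distinct and \<open>S\<close> is symmetric: an edge determines its two
  positions in \<open>ws\<close> up to a swap.
\<close>

definition schur_weight :: "'a list \<Rightarrow> real mat \<Rightarrow> 'a set \<Rightarrow> real" where
  "schur_weight ws S e =
     (THE x. \<exists>i j. i < length ws \<and> j < length ws \<and> i \<noteq> j \<and>
        e = {ws ! i, ws ! j} \<and> x = - S $$ (i, j))"

text \<open>
  Eigenvalues are taken over the complex numbers, with algebraic multiplicity (the order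
  as a root of the characteristic polynomial).
\<close>

definition pseudo_det :: "real mat \<Rightarrow> complex" where
  "pseudo_det M = (let M' = map_mat complex_of_real M in
     \<Prod>z | eigenvalue M' z \<and> z \<noteq> 0. z ^ order z (char_poly M'))"

end

theory Submission
  imports Defs
begin

text \<open>
  Both statements are forms of one determinant identity. Let \<open>r\<close> be a vertex of \<open>Y\<close> and delete
  the row and column of \<open>r\<close> from the Laplacian of \<open>G\<close>. Since \<open>r\<close> lies outside the block \<open>A\<close>,
  eliminating \<open>A\<close> shows that the reduced determinant of the Laplacian is \<open>det A\<close> times the
  determinant of \<open>S\<close> with \<open>r\<close> deleted. By the weighted matrix-tree theorem
  (\<open>weighted_matrix_tree\<close>) the two reduced determinants are the spanning tree enumerators of \<open>G\<close>
  with unit weights and of the Schur complement graph. This is statement (a), up to the fact that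
  the pseudo-determinant of the invertible matrix \<open>A\<close> is its determinant; it is proved in
  \<open>spanning_trees_schur_complement\<close>. For (b), the pseudo-determinant of a weighted Laplacian on
  \<open>n\<close> vertices whose enumerator is not zero is \<open>n\<close> times that enumerator
  (\<open>pseudo_det_weighted_laplacian\<close>). Substituting this for \<open>L(G)\<close> and for \<open>S\<close> cancels the
  factors \<open>|V(G)|\<close> and \<open>|V(Y)|\<close> and leaves (a) again. So (a) and (b) are not only equivalent but
  both true.

  The matrix-tree theorem comes from expanding the determinant by multilinearity. Each row of the
  reduced Laplacian is a weighted sum of vectors \<open>e\<^sub>u - e\<^sub>x\<close>, so its determinant expands
  into a sum over functions choosing an \<open>x\<close> for every non-root vertex \<open>u\<close>. The term of a function
  is the product of the chosen weights if iterating the function leads from everywhere to the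
  root, and zero otherwise; and such functions are the same as spanning trees with all edges
  directed towards the root.

  That enumerators do not vanish, and that \<open>A\<close> is invertible, comes from the energy form of a
  connected graph (\<open>dirichlet_problem_unique\<close>).
\<close>

section \<open>Rooted spanning trees as parent functions\<close>

text \<open>
  A spanning tree with a chosen root \<open>r\<close> is recorded by the map sending every other vertex to
  the next vertex on its path to \<open>r\<close>. Such a map is kept extensional so that the tree
  determines it. At \<open>r\<close> itself the exponent \<open>k = 0\<close> satisfies the last condition, so the value
  \<open>undefined\<close> taken there never enters.
\<close>

definition parent_functions :: "'a graph \<Rightarrow> 'a \<Rightarrow> ('a \<Rightarrow> 'a) set" where
  "parent_functions H r =
     {f \<in> (verts H - {r}) \<rightarrow>\<^sub>E verts H.
        (\<forall>v\<in>verts H - {r}. {v, f v} \<in> edges H) \<and> (\<forall>v\<in>verts H. \<exists>k. (f ^^ k) v = r)}"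

definition parent_tree :: "'a graph \<Rightarrow> 'a \<Rightarrow> ('a \<Rightarrow> 'a) \<Rightarrow> 'a graph" where
  "parent_tree H r f = \<lparr>verts = verts H, edges = (\<lambda>v. {v, f v}) ` (verts H - {r})\<rparr>"

lemma finite_simple_edgeD:
  assumes "finite_simple_graph H" "{u, v} \<in> edges H"
  shows "u \<in> verts H" "v \<in> verts H" "u \<noteq> v"
  using assms unfolding finite_simple_graph_def by (metis doubleton_eq_iff)+

text \<open>
  The depth of a vertex is the least number of steps of \<open>f\<close> that lead to \<open>r\<close>. It is the measure
  in the inductions and extremal arguments about parent functions below.
\<close>

lemma depth_function:
  assumes "\<forall>v\<in>V. \<exists>k. (f ^^ k) v = r"
  shows "\<exists>d :: 'a \<Rightarrow> nat. \<forall>v\<in>V - {r}. d (f v) < d v"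
proof (intro exI ballI)
  fix v assume v: "v \<in> V - {r}"
  let ?d = "\<lambda>v. LEAST k. (f ^^ k) v = r"
  have "\<exists>k. (f ^^ k) v = r" using assms v by blast
  then have eq: "(f ^^ ?d v) v = r" by (rule LeastI_ex)
  then obtain j where j: "?d v = Suc j" using v by (cases "?d v") auto
  from eq have "(f ^^ j) (f v) = r" unfolding j by (simp add: funpow_swap1)
  then have "?d (f v) \<le> j" by (rule Least_le)
  then show "?d (f v) < ?d v" using j by simp
qed

lemma parent_functionsD:
  assumes "f \<in> parent_functions H r" "v \<in> verts H" "v \<noteq> r"
  shows "f v \<in> verts H" "{v, f v} \<in> edges H"
  using assms unfolding parent_functions_def by auto

lemma parent_functions_depth:
  assumes "f \<in> parent_functions H r"
  obtains d :: "'a \<Rightarrow> nat" where "\<And>v. v \<in> verts H \<Longrightarrow> v \<noteq> r \<Longrightarrow> d (f v) < d v"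
proof -
  have "\<forall>v\<in>verts H. \<exists>k. (f ^^ k) v = r" using assms by (simp add: parent_functions_def)
  from depth_function[OF this] show thesis using that by blast
qed

lemma parent_tree_edge_iff:
  "{x, y} \<in> edges (parent_tree H r f) \<longleftrightarrow>
     (x \<in> verts H - {r} \<and> y = f x) \<or> (y \<in> verts H - {r} \<and> x = f y)"
  unfolding parent_tree_def by (auto simp: doubleton_eq_iff image_iff)

lemma parent_tree_connected:
  assumes f: "f \<in> parent_functions H r" and r: "r \<in> verts H"
  shows "connected_graph (parent_tree H r f)"
proof -
  let ?R = "{(x, y). {x, y} \<in> edges (parent_tree H r f)}"
  obtain d :: "_ \<Rightarrow> nat" where d: "\<And>v. v \<in> verts H \<Longrightarrow> v \<noteq> r \<Longrightarrow> d (f v) < d v"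
    using parent_functions_depth[OF f] by blast
  have to_root: "(v, r) \<in> ?R\<^sup>*" if "v \<in> verts H" for v
    using that
  proof (induction "d v" arbitrary: v rule: less_induct)
    case less
    show ?case
    proof (cases "v = r")
      case False
      have "(v, f v) \<in> ?R" using less(2) False by (auto simp: parent_tree_edge_iff)
      moreover have "(f v, r) \<in> ?R\<^sup>*"
        using less parent_functionsD[OF f] d False by blast
      ultimately show ?thesis by (rule converse_rtrancl_into_rtrancl)
    qed auto
  qed
  have "sym (?R\<^sup>*)" by (rule sym_rtrancl) (auto simp: sym_def insert_commute)
  then have "(u, v) \<in> ?R\<^sup>*" if "u \<in> verts H" "v \<in> verts H" for u v
    using to_root[OF that(1)] to_root[OF that(2)] by (meson symD rtrancl_trans)
  then show ?thesis using r unfolding connected_graph_def by (auto simp: parent_tree_def)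
qed

text \<open>
  Take a deepest vertex on the cycle. Of the two ends of a tree edge one is the parent of the
  other and less deep, so both neighbours of the deepest vertex on the cycle are its parent; but
  on a cycle of length at least three they are distinct.
\<close>

lemma parent_tree_no_cycle:
  assumes f: "f \<in> parent_functions H r"
  shows "\<not> is_cycle (parent_tree H r f) vs"
proof
  assume cyc: "is_cycle (parent_tree H r f) vs"
  obtain d :: "_ \<Rightarrow> nat" where d: "\<And>v. v \<in> verts H \<Longrightarrow> v \<noteq> r \<Longrightarrow> d (f v) < d v"
    using parent_functions_depth[OF f] by blast
  define n where "n = length vs"
  have n: "3 \<le> n" and dist: "distinct vs"
    and step: "\<And>i. i < n \<Longrightarrow> {vs ! i, vs ! (Suc i mod n)} \<in> edges (parent_tree H r f)"
    using cyc unfolding is_cycle_def n_def by auto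
  have "Max (d ` set vs) \<in> d ` set vs" using n unfolding n_def by (intro Max_in) auto
  then obtain i where i: "i < n" and max: "d (vs ! i) = Max (d ` set vs)"
    unfolding n_def by (auto simp: in_set_conv_nth)
  have le: "d (vs ! j) \<le> d (vs ! i)" if "j < n" for j
    unfolding max using that n_def by (intro Max_ge) auto
  have up: "vs ! j = f (vs ! i)"
    if "j < n" "{vs ! i, vs ! j} \<in> edges (parent_tree H r f)" for j
    using that(2) d[of "vs ! j"] le[OF that(1)] unfolding parent_tree_edge_iff by auto
  \<comment> \<open>the predecessor of \<open>i\<close> on the cycle\<close>
  define j where "j = (if i = 0 then n - 1 else i - 1)"
  have j: "j < n" "Suc j mod n = i" using i n by (auto simp: j_def)
  have "vs ! j = f (vs ! i)"
    using up[OF j(1)] step[OF j(1)] j(2) by (simp add: insert_commute)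
  moreover have "vs ! (Suc i mod n) = f (vs ! i)"
    using up[of "Suc i mod n"] step[OF i] n by simp
  ultimately have "j = Suc i mod n"
    using dist j(1) n unfolding n_def by (metis mod_less_divisor nth_eq_iff_index_eq
      zero_less_numeral less_le_trans)
  then show False using i n by (auto simp: j_def mod_Suc split: if_splits)
qed

lemma parent_tree_spanning:
  assumes H: "finite_simple_graph H" and r: "r \<in> verts H" and f: "f \<in> parent_functions H r"
  shows "parent_tree H r f \<in> spanning_trees H"
proof -
  have "\<exists>x\<in>verts H. \<exists>y\<in>verts H. x \<noteq> y \<and> {v, f v} = {x, y}" if "v \<in> verts H - {r}" for v
    using parent_functionsD[OF f, of v] finite_simple_edgeD[OF H, of v "f v"] that by blast
  then have "finite_simple_graph (parent_tree H r f)"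
    using H unfolding finite_simple_graph_def parent_tree_def by simp
  moreover have "edges (parent_tree H r f) \<subseteq> edges H" "verts (parent_tree H r f) = verts H"
    using parent_functionsD[OF f] by (auto simp: parent_tree_def)
  ultimately show ?thesis
    using parent_tree_connected[OF f r] parent_tree_no_cycle[OF f]
    unfolding spanning_trees_def is_subgraph_def is_tree_def by auto
qed

text \<open>
  By induction on depth, \<open>f\<close> can be read off from the tree: the edge \<open>{v, f v}\<close> either is the
  edge from \<open>v\<close> to \<open>g v\<close>, or leads from \<open>f v\<close> to its \<open>g\<close>-parent \<open>v\<close>. In the second case \<open>v\<close>
  would be, by induction, also the \<open>f\<close>-parent of \<open>f v\<close>, although it is deeper.
\<close>

lemma parent_tree_inj: "inj_on (parent_tree H r) (parent_functions H r)"
proof (rule inj_onI)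
  fix f g assume f: "f \<in> parent_functions H r" and g: "g \<in> parent_functions H r"
    and eq: "parent_tree H r f = parent_tree H r g"
  obtain d :: "_ \<Rightarrow> nat" where d: "\<And>v. v \<in> verts H \<Longrightarrow> v \<noteq> r \<Longrightarrow> d (f v) < d v"
    using parent_functions_depth[OF f] by blast
  have "f v = g v" if "v \<in> verts H - {r}" for v
    using that
  proof (induction "d v" arbitrary: v rule: less_induct)
    case less
    have "{v, f v} \<in> edges (parent_tree H r g)"
      using less(2) unfolding eq[symmetric] by (simp add: parent_tree_edge_iff)
    then consider "f v = g v" | "f v \<in> verts H - {r}" "g (f v) = v"
      unfolding parent_tree_edge_iff by auto
    then show ?case
    proof cases
      case 2
      then have "f (f v) = v" using less d by auto
      then show ?thesis using d[of v] d[of "f v"] 2 less(2) by simp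
    qed
  qed
  then show "f = g" using f g unfolding parent_functions_def by (auto intro: PiE_ext)
qed

lemma rtrancl_imp_distinct_path:
  assumes "(a, b) \<in> R\<^sup>*"
  obtains xs where "xs \<noteq> []" "hd xs = a" "last xs = b" "distinct xs"
    "successively (\<lambda>x y. (x, y) \<in> R) xs"
  using assms
proof (induction arbitrary: thesis rule: converse_rtrancl_induct)
  case base
  show ?case by (rule base[of "[b]"]) auto
next
  case (step a c)
  obtain xs where xs: "xs \<noteq> []" "hd xs = c" "last xs = b" "distinct xs"
    "successively (\<lambda>x y. (x, y) \<in> R) xs" by (rule step.IH)
  show ?case
  proof (cases "a \<in> set xs")
    case True
    then obtain ys zs where "xs = ys @ a # zs" by (meson split_list)
    then show ?thesis using xs by (intro step.prems[of "a # zs"]) (auto simp: successively_append_iff)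
  next
    case False
    then show ?thesis using xs step.hyps
      by (intro step.prems[of "a # xs"]) (auto simp: successively_Cons)
  qed
qed

text \<open>
  A path without repetition in \<open>F\<close> from \<open>a\<close> to \<open>b\<close> is closed up by the extra edge. It visits at
  least three vertices because \<open>{a, b}\<close> is not an edge of \<open>F\<close>.
\<close>

lemma edge_outside_connected_subgraph_closes_cycle:
  assumes F: "connected_graph F" "edges F \<subseteq> edges T"
    and ab: "a \<in> verts F" "b \<in> verts F" "a \<noteq> b" "{a, b} \<in> edges T" "{a, b} \<notin> edges F"
  shows "\<exists>vs. is_cycle T vs"
proof -
  have "(a, b) \<in> {(x, y). {x, y} \<in> edges F}\<^sup>*"
    using F(1) ab unfolding connected_graph_def by blast
  then obtain xs where xs: "xs \<noteq> []" "hd xs = a" "last xs = b" "distinct xs"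
    "successively (\<lambda>x y. {x, y} \<in> edges F) xs" by (auto elim: rtrancl_imp_distinct_path)
  have "3 \<le> length xs"
  proof (rule ccontr)
    assume "\<not> ?thesis"
    then consider x where "xs = [x]" | x y where "xs = [x, y]"
      using xs(1) by (cases xs rule: remdups_adj.cases) (auto simp: Suc_le_eq)
    then show False using xs ab by cases auto
  qed
  moreover have "{xs ! i, xs ! (Suc i mod length xs)} \<in> edges T" if "i < length xs" for i
  proof (cases "Suc i < length xs")
    case True
    then show ?thesis using xs(5) F(2) by (auto simp: successively_conv_nth)
  next
    case False
    then have "Suc i = length xs" using that by simp
    then have "xs ! i = b" "xs ! (Suc i mod length xs) = a"
      using xs(1-3) by (simp_all add: last_conv_nth hd_conv_nth flip: \<open>Suc i = length xs\<close>)
    then show ?thesis using ab(4) by (simp add: insert_commute)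
  qed
  ultimately show ?thesis using xs(4) unfolding is_cycle_def by blast
qed

text \<open>
  Let \<open>f v\<close> be a neighbour of \<open>v\<close> in \<open>T\<close> that is closer to \<open>r\<close>. The tree of \<open>f\<close> is then a
  connected spanning subgraph of \<open>T\<close>, and it is all of \<open>T\<close> since a further edge would close a
  cycle.
\<close>

lemma parent_tree_surj:
  assumes r: "r \<in> verts H" and T: "T \<in> spanning_trees H"
  shows "\<exists>f\<in>parent_functions H r. parent_tree H r f = T"
proof -
  have sub: "edges T \<subseteq> edges H" and V: "verts T = verts H" and fs: "finite_simple_graph T"
    and con: "connected_graph T" and acyc: "\<nexists>vs. is_cycle T vs"
    using T unfolding spanning_trees_def is_subgraph_def is_tree_def by auto
  let ?R = "{(x, y). {x, y} \<in> edges T}"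
  define d where "d v = (LEAST n. (v, r) \<in> ?R ^^ n)" for v
  have "\<exists>u. {v, u} \<in> edges T \<and> d u < d v" if v: "v \<in> verts H - {r}" for v
  proof -
    have "(v, r) \<in> ?R\<^sup>*" using con v r V unfolding connected_graph_def by blast
    then have *: "(v, r) \<in> ?R ^^ d v"
      unfolding d_def rtrancl_power by (metis (no_types, lifting) LeastI_ex)
    then obtain n where n: "d v = Suc n" using v by (cases "d v") auto
    obtain u where "(v, u) \<in> ?R" and u: "(u, r) \<in> ?R ^^ n"
      using * unfolding n by (meson relpow_Suc_D2)
    moreover have "d u \<le> n" unfolding d_def using u by (rule Least_le)
    ultimately show ?thesis using n by auto
  qed
  then obtain g where g: "\<And>v. v \<in> verts H - {r} \<Longrightarrow> {v, g v} \<in> edges T \<and> d (g v) < d v"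
    by metis
  define f where "f = restrict g (verts H - {r})"
  have fT: "{v, f v} \<in> edges T" "d (f v) < d v" "f v \<in> verts H" if "v \<in> verts H - {r}" for v
    using g[OF that] that finite_simple_edgeD[OF fs] V by (auto simp: f_def)
  have "\<exists>k. (f ^^ k) v = r" if "v \<in> verts H" for v
    using that
  proof (induction "d v" arbitrary: v rule: less_induct)
    case less
    show ?case
    proof (cases "v = r")
      case True
      then have "(f ^^ 0) v = r" by simp
      then show ?thesis by blast
    next
      case False
      then obtain k where "(f ^^ k) (f v) = r" using less fT[of v] by blast
      then have "(f ^^ Suc k) v = r" by (simp add: funpow_swap1)
      then show ?thesis by blast
    qed
  qed
  then have f: "f \<in> parent_functions H r"
    using fT(1,3) sub unfolding parent_functions_def
    by (simp add: PiE_iff subset_iff) (simp add: f_def)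
  have le: "edges (parent_tree H r f) \<subseteq> edges T" using fT by (auto simp: parent_tree_def)
  have "e \<in> edges (parent_tree H r f)" if e: "e \<in> edges T" for e
  proof (rule ccontr)
    assume out: "e \<notin> edges (parent_tree H r f)"
    obtain a b where ab: "a \<in> verts T" "b \<in> verts T" "a \<noteq> b" "e = {a, b}"
      using fs e unfolding finite_simple_graph_def by blast
    then show False
      using edge_outside_connected_subgraph_closes_cycle[OF parent_tree_connected[OF f r] le]
        acyc e out V by (auto simp: parent_tree_def)
  qed
  then have "edges (parent_tree H r f) = edges T" using le by blast
  then have "parent_tree H r f = T" using V by (simp add: parent_tree_def)
  then show ?thesis using f by blast
qed

lemma bij_betw_parent_tree:
  assumes "finite_simple_graph H" "r \<in> verts H"
  shows "bij_betw (parent_tree H r) (parent_functions H r) (spanning_trees H)"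
proof (rule bij_betw_imageI)
  show "inj_on (parent_tree H r) (parent_functions H r)" by (rule parent_tree_inj)
  show "parent_tree H r ` parent_functions H r = spanning_trees H"
  proof
    show "parent_tree H r ` parent_functions H r \<subseteq> spanning_trees H"
      using parent_tree_spanning[OF assms] by (rule image_subsetI)
    show "spanning_trees H \<subseteq> parent_tree H r ` parent_functions H r"
      using parent_tree_surj[OF assms(2)] by (metis image_eqI subsetI)
  qed
qed

text \<open>
  Sending a vertex to the edge towards its parent is injective: two vertices sharing this edge
  would be parents of each other.
\<close>

lemma prod_parent_tree:
  assumes f: "f \<in> parent_functions H r"
  shows "(\<Prod>e\<in>edges (parent_tree H r f). w e) = (\<Prod>v\<in>verts H - {r}. w {v, f v})"
proof -
  obtain d :: "_ \<Rightarrow> nat" where d: "\<And>v. v \<in> verts H \<Longrightarrow> v \<noteq> r \<Longrightarrow> d (f v) < d v"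
    using parent_functions_depth[OF f] by blast
  have "inj_on (\<lambda>v. {v, f v}) (verts H - {r})"
  proof (rule inj_onI)
    fix u v assume uv: "u \<in> verts H - {r}" "v \<in> verts H - {r}" and eq: "{u, f u} = {v, f v}"
    show "u = v"
    proof (rule ccontr)
      assume "u \<noteq> v"
      then have "f u = v" "f v = u" using eq by (auto simp: doubleton_eq_iff)
      then show False using d[of u] d[of v] uv by simp
    qed
  qed
  then show ?thesis unfolding parent_tree_def by (simp add: prod.reindex)
qed

section \<open>The weighted matrix-tree theorem\<close>

lemma sum_nth_distinct:
  assumes "distinct xs"
  shows "(\<Sum>i = 0..<length xs. h (xs ! i)) = (\<Sum>x\<in>set xs. h x)"
  using assms by (intro sum.reindex_bij_betw) (simp add: bij_betw_nth atLeast0LessThan)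

lemma prod_nth_distinct:
  assumes "distinct xs"
  shows "(\<Prod>i = 0..<length xs. h (xs ! i)) = (\<Prod>x\<in>set xs. h x)"
  using assms by (intro prod.reindex_bij_betw) (simp add: bij_betw_nth atLeast0LessThan)

text \<open>
  Passes from values indexed by positions in a list, such as the entries of a vector, to a
  function on vertices.
\<close>

lemma distinct_nth_extend:
  assumes "distinct xs"
  obtains X where "\<And>i. i < length xs \<Longrightarrow> X (xs ! i) = g i" "\<And>v. v \<notin> set xs \<Longrightarrow> X v = c"
proof
  let ?inv = "the_inv_into {..<length xs} ((!) xs)"
  let ?X = "\<lambda>v. if v \<in> set xs then g (?inv v) else c"
  show "?X (xs ! i) = g i" if "i < length xs" for i
    using that assms by (simp add: the_inv_into_f_f inj_on_nth)
  show "?X v = c" if "v \<notin> set xs" for v using that by simp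
qed

text \<open>
  Expanding a product of sums over list positions, with the choice functions defined on the
  elements of the list: this is the form in which they become candidate parent functions.
\<close>

lemma prod_sum_PiE_nth:
  fixes K :: "nat \<Rightarrow> 'a \<Rightarrow> 'b :: comm_semiring_1"
  assumes us: "distinct us" and V: "finite V"
  shows "(\<Prod>i = 0..<length us. \<Sum>x\<in>V. K i x) =
    (\<Sum>f\<in>set us \<rightarrow>\<^sub>E V. \<Prod>i = 0..<length us. K i (f (us ! i)))"
proof -
  obtain idx where idx: "\<And>i. i < length us \<Longrightarrow> idx (us ! i) = i"
    using distinct_nth_extend[OF us, of "\<lambda>i. i"] by blast
  have "(\<Prod>i = 0..<length us. \<Sum>x\<in>V. K i x) = (\<Prod>i = 0..<length us. \<Sum>x\<in>V. K (idx (us ! i)) x)"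
    by (simp add: idx)
  also have "\<dots> = (\<Prod>v\<in>set us. \<Sum>x\<in>V. K (idx v) x)" by (rule prod_nth_distinct[OF us])
  also have "\<dots> = (\<Sum>f\<in>set us \<rightarrow>\<^sub>E V. \<Prod>v\<in>set us. K (idx v) (f v))"
    using V by (intro prod_sum_PiE) auto
  also have "\<dots> = (\<Sum>f\<in>set us \<rightarrow>\<^sub>E V. \<Prod>i = 0..<length us. K i (f (us ! i)))"
    by (intro sum.cong refl, subst prod_nth_distinct[OF us, symmetric]) (simp add: idx)
  finally show ?thesis .
qed

definition indexed_mat :: "('a \<Rightarrow> 'a \<Rightarrow> 'b) \<Rightarrow> 'a list \<Rightarrow> 'b mat" where
  "indexed_mat M vs = mat (length vs) (length vs) (\<lambda>(i, j). M (vs ! i) (vs ! j))"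

lemma indexed_mat_carrier [simp]: "indexed_mat M vs \<in> carrier_mat (length vs) (length vs)"
  by (simp add: indexed_mat_def)

lemma dim_indexed_mat [simp]:
  "dim_row (indexed_mat M vs) = length vs" "dim_col (indexed_mat M vs) = length vs"
  by (simp_all add: indexed_mat_def)

definition weighted_laplacian :: "'a graph \<Rightarrow> ('a set \<Rightarrow> real) \<Rightarrow> 'a \<Rightarrow> 'a \<Rightarrow> real" where
  "weighted_laplacian H w u v =
     (if u = v then \<Sum>x | x \<in> verts H \<and> {u, x} \<in> edges H. w {u, x}
      else if {u, v} \<in> edges H then - w {u, v} else 0)"

abbreviation edge_weight :: "'a graph \<Rightarrow> ('a set \<Rightarrow> real) \<Rightarrow> 'a \<Rightarrow> 'a \<Rightarrow> real" where
  "edge_weight H w u v \<equiv> (if {u, v} \<in> edges H then w {u, v} else 0)"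

text \<open>
  Row \<open>u\<close> of the Laplacian is the sum over the edges \<open>{u, x}\<close> of their weights times
  \<open>e\<^sub>u - e\<^sub>x\<close>. Expanding the determinant in all rows at once therefore chooses one \<open>x\<close> for every
  \<open>u\<close>.
\<close>

lemma weighted_laplacian_expand:
  assumes H: "finite_simple_graph H" and u: "u \<in> verts H" and v: "v \<in> verts H"
  shows "weighted_laplacian H w u v =
    (\<Sum>x\<in>verts H. edge_weight H w u x * (of_bool (v = u) - of_bool (v = x)))"
proof -
  have fin: "finite (verts H)" using H by (simp add: finite_simple_graph_def)
  have loop: "{u} \<notin> edges H" using finite_simple_edgeD(3)[OF H, of u u] by auto
  show ?thesis
  proof (cases "v = u")
    case True
    have "edge_weight H w u x * (of_bool (u = u) - of_bool (u = x)) = edge_weight H w u x" for x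
      using loop by (cases "x = u") auto
    then have "(\<Sum>x\<in>verts H. edge_weight H w u x * (of_bool (u = u) - of_bool (u = x))) =
      (\<Sum>x\<in>verts H. edge_weight H w u x)" by (simp only:)
    then show ?thesis using fin unfolding True
      by (simp add: weighted_laplacian_def sum.inter_filter)
  next
    case False
    then have "edge_weight H w u x * (of_bool (v = u) - of_bool (v = x)) =
      (if x = v then - edge_weight H w u v else 0)" for x by auto
    then show ?thesis using fin False v by (simp add: weighted_laplacian_def)
  qed
qed

lemma weighted_laplacian_apply:
  assumes H: "finite_simple_graph H" and u: "u \<in> verts H"
  shows "(\<Sum>v\<in>verts H. weighted_laplacian H w u v * X v) =
    (\<Sum>x\<in>verts H. edge_weight H w u x * (X u - X x))"
proof -
  have fin: "finite (verts H)" using H by (simp add: finite_simple_graph_def)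
  let ?c = "edge_weight H w u"
  have "(\<Sum>v\<in>verts H. weighted_laplacian H w u v * X v) =
    (\<Sum>v\<in>verts H. \<Sum>x\<in>verts H. ?c x * (of_bool (v = u) - of_bool (v = x)) * X v)"
    by (intro sum.cong refl) (simp add: weighted_laplacian_expand[OF H u] sum_distrib_right)
  also have "\<dots> = (\<Sum>x\<in>verts H. \<Sum>v\<in>verts H. ?c x * (of_bool (v = u) - of_bool (v = x)) * X v)"
    by (rule sum.swap)
  also have "\<dots> = (\<Sum>x\<in>verts H. ?c x * (X u - X x))"
  proof (rule sum.cong[OF refl])
    fix x assume x: "x \<in> verts H"
    have "(\<Sum>v\<in>verts H. ?c x * (of_bool (v = u) - of_bool (v = x)) * X v) =
      ?c x * (\<Sum>v\<in>verts H. (if v = u then X v else 0) - (if v = x then X v else 0))"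
      unfolding sum_distrib_left by (intro sum.cong refl) (auto simp: algebra_simps)
    also have "\<dots> = ?c x * (X u - X x)" using fin u x by (simp add: sum_subtractf)
    finally show "(\<Sum>v\<in>verts H. ?c x * (of_bool (v = u) - of_bool (v = x)) * X v) =
      ?c x * (X u - X x)" .
  qed
  finally show ?thesis .
qed

text \<open>
  The Laplacian of the directed graph with one arrow from each \<open>u\<close> to \<open>f u\<close>. On a list of
  vertices without the root it is the identity minus the adjacency matrix of these arrows, where
  arrows to the root leave no trace.
\<close>

definition functional_laplacian :: "('a \<Rightarrow> 'a) \<Rightarrow> 'a \<Rightarrow> 'a \<Rightarrow> real" where
  "functional_laplacian f u v = of_bool (v = u) - of_bool (v = f u)"

text \<open>
  In the Leibniz formula only the identity contributes. A non-zero entry off the diagonal at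
  \<open>(i, p i)\<close> means that \<open>p\<close> moves \<open>i\<close> to its parent, which is less deep and also moved; this
  fails at a moved index of least depth.
\<close>

lemma det_functional_laplacian_rooted:
  assumes us: "distinct us" and reach: "\<forall>v\<in>insert r (set us). \<exists>k. (f ^^ k) v = r"
    and r: "r \<notin> set us"
  shows "det (indexed_mat (functional_laplacian f) us) = 1"
proof -
  let ?m = "length us" and ?M = "indexed_mat (functional_laplacian f) us"
  obtain d :: "_ \<Rightarrow> nat" where d: "\<And>v. v \<in> set us \<Longrightarrow> d (f v) < d v"
    using depth_function[OF reach] r by auto
  let ?term = "\<lambda>p. signof p * (\<Prod>i = 0..<?m. ?M $$ (i, p i))"
  have zero: "?term p = 0" if p: "p permutes {0..<?m}" and ne: "p \<noteq> id" for p
  proof -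
    let ?moved = "{i. i < ?m \<and> p i \<noteq> i}"
    have "?moved \<noteq> {}"
    proof
      assume "?moved = {}"
      then have "p i = i" for i using permutes_not_in[OF p, of i] by (cases "i < ?m") auto
      then show False using ne by auto
    qed
    then obtain i0 where i0: "i0 < ?m \<and> p i0 \<noteq> i0" by blast
    define i where "i = arg_min (\<lambda>i. d (us ! i)) (\<lambda>i. i < ?m \<and> p i \<noteq> i)"
    have i: "i < ?m" "p i \<noteq> i"
      using arg_min_natI[of "\<lambda>i. i < ?m \<and> p i \<noteq> i", OF i0, of "\<lambda>i. d (us ! i)"]
      unfolding i_def by auto
    have min: "d (us ! i) \<le> d (us ! j)" if "j < ?m" "p j \<noteq> j" for j
      unfolding i_def using that by (intro arg_min_nat_le) simp
    have pi: "p i < ?m" using permutes_in_image[OF p, of i] i by simp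
    have "p (p i) \<noteq> p i" using permutes_inj[OF p] i by (metis injD)
    then have "us ! p i \<noteq> f (us ! i)" using min[OF pi] d[of "us ! i"] i by force
    moreover have "us ! p i \<noteq> us ! i" using us i pi by (simp add: nth_eq_iff_index_eq)
    ultimately have "?M $$ (i, p i) = 0"
      using i pi by (simp add: indexed_mat_def functional_laplacian_def)
    then show ?thesis using i by (auto intro!: prod_zero)
  qed
  have diag: "?M $$ (i, i) = 1" if "i < ?m" for i
    using that d[of "us ! i"] by (auto simp: indexed_mat_def functional_laplacian_def)
  have "det ?M = (\<Sum>p | p permutes {0..<?m}. ?term p)" by (rule det_def') simp
  also have "\<dots> = (\<Sum>p\<in>{id}. ?term p)"
  proof (rule sum.mono_neutral_right)
    show "\<forall>p\<in>{p. p permutes {0..<?m}} - {id}. ?term p = 0" using zero by blast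
  qed (simp_all add: finite_permutations permutes_id)
  also have "\<dots> = 1" using diag by (simp add: sign_id)
  finally show ?thesis .
qed

text \<open>
  The indicator function of the vertices that never reach the root is constant along arrows and
  zero at the root, so it lies in the kernel.
\<close>

lemma det_functional_laplacian_unrooted:
  assumes us: "distinct us" and f: "\<And>v. v \<in> set us \<Longrightarrow> f v \<in> insert r (set us)"
    and r: "r \<notin> set us" and v: "v \<in> insert r (set us)" "\<And>k. (f ^^ k) v \<noteq> r"
  shows "det (indexed_mat (functional_laplacian f) us) = 0"
proof -
  let ?m = "length us" and ?M = "indexed_mat (functional_laplacian f) us"
  define X :: "_ \<Rightarrow> real" where "X u = of_bool (\<forall>k. (f ^^ k) u \<noteq> r)" for u
  let ?x = "vec ?m (\<lambda>i. X (us ! i))"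
  have Xr: "X r = 0" by (auto simp: X_def intro: exI[of _ 0])
  have Xf: "X (f u) = X u" if u: "u \<in> set us" "u \<noteq> r" for u
  proof -
    have "(\<exists>k. (f ^^ k) u = r) \<longleftrightarrow> (\<exists>k. (f ^^ k) (f u) = r)"
    proof
      assume "\<exists>k. (f ^^ k) u = r"
      then obtain k where k: "(f ^^ k) u = r" by blast
      then obtain j where "k = Suc j" using u by (cases k) auto
      then show "\<exists>k. (f ^^ k) (f u) = r" using k by (auto simp: funpow_swap1)
    next
      assume "\<exists>k. (f ^^ k) (f u) = r"
      then obtain k where "(f ^^ Suc k) u = r" by (auto simp: funpow_swap1)
      then show "\<exists>k. (f ^^ k) u = r" by blast
    qed
    then show ?thesis unfolding X_def of_bool_eq_iff by blast
  qed
  have "v \<noteq> r" using v(2)[of 0] by auto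
  then obtain i where i: "i < ?m" "us ! i = v" using v(1) by (auto simp: in_set_conv_nth)
  have "X v = 1" using v(2) by (simp add: X_def)
  then have "?x $ i \<noteq> 0\<^sub>v ?m $ i" using i by simp
  then have ne: "?x \<noteq> 0\<^sub>v ?m" by metis
  have "?M *\<^sub>v ?x = 0\<^sub>v ?m"
  proof (rule eq_vecI)
    fix i assume "i < dim_vec (0\<^sub>v ?m :: real vec)"
    then have i: "i < ?m" by simp
    have ui: "us ! i \<in> set us" using i by simp
    have "(?M *\<^sub>v ?x) $ i = (\<Sum>j = 0..<?m. functional_laplacian f (us ! i) (us ! j) * X (us ! j))"
      using i by (simp add: indexed_mat_def scalar_prod_def)
    also have "\<dots> = (\<Sum>u\<in>set us. functional_laplacian f (us ! i) u * X u)"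
      by (rule sum_nth_distinct[OF us])
    also have "\<dots> = (\<Sum>u\<in>set us. (if u = us ! i then X u else 0) - (if u = f (us ! i) then X u else 0))"
      by (intro sum.cong) (auto simp: functional_laplacian_def)
    also have "\<dots> = X (us ! i) - (if f (us ! i) \<in> set us then X (f (us ! i)) else 0)"
      using ui by (simp add: sum_subtractf)
    also have "\<dots> = 0"
    proof -
      have "us ! i \<noteq> r" using ui r by auto
      moreover have "f (us ! i) \<notin> set us \<Longrightarrow> X (f (us ! i)) = 0" using f[OF ui] Xr by auto
      ultimately show ?thesis using Xf[OF ui] by auto
    qed
    finally show "(?M *\<^sub>v ?x) $ i = 0\<^sub>v ?m $ i" using i by simp
  qed simp
  then show ?thesis using ne
    by (subst det_0_iff_vec_prod_zero[of _ ?m]) (auto intro!: exI[of _ ?x])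
qed

text \<open>
  The reduced determinant is multilinear in its rows, so it is a sum over all functions
  \<open>f\<close> from the non-root vertices to the vertices, of the product of the weights of the pairs
  \<open>{v, f v}\<close> times the determinant of the functional Laplacian of \<open>f\<close>. That determinant is 1 if
  \<open>f\<close> leads everywhere to the root and 0 otherwise. Once the pairs that are not edges,
  which have weight zero, are discarded, the functions that survive are the parent functions of
  the spanning trees.
\<close>

lemma weighted_matrix_tree:
  assumes H: "finite_simple_graph H" and r: "r \<in> verts H"
    and us: "distinct us" "set us = verts H - {r}"
  shows "det (indexed_mat (weighted_laplacian H w) us) = spanning_tree_enumerator H w"
proof -
  let ?m = "length us" and ?V = "verts H" and ?c = "edge_weight H w"
  let ?F = "set us \<rightarrow>\<^sub>E ?V"
  let ?P = "{p. p permutes {0..<?m}}"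
  have fin: "finite ?V" using H by (simp add: finite_simple_graph_def)
  have V: "?V = insert r (set us)" "r \<notin> set us" using us r by auto
  have perm: "p i < ?m" if "p permutes {0..<?m}" "i < ?m" for p i
    using permutes_in_image[OF that(1), of i] that(2) by simp
  have entry: "indexed_mat (weighted_laplacian H w) us $$ (i, p i) =
      (\<Sum>x\<in>?V. ?c (us ! i) x * (of_bool (us ! p i = us ! i) - of_bool (us ! p i = x)))"
    if "p permutes {0..<?m}" "i \<in> {0..<?m}" for p i
  proof -
    have "p i < ?m" using perm that by simp
    then have "us ! i \<in> ?V" "us ! p i \<in> ?V" using that(2) V by auto
    then show ?thesis using that(2) \<open>p i < ?m\<close> weighted_laplacian_expand[OF H, of "us ! i" "us ! p i"]
      by (simp add: indexed_mat_def)
  qed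
  have "det (indexed_mat (weighted_laplacian H w) us) =
    (\<Sum>p\<in>?P. signof p * (\<Prod>i = 0..<?m. indexed_mat (weighted_laplacian H w) us $$ (i, p i)))"
    by (rule det_def') simp
  also have "\<dots> = (\<Sum>p\<in>?P. signof p * (\<Prod>i = 0..<?m.
      \<Sum>x\<in>?V. ?c (us ! i) x * (of_bool (us ! p i = us ! i) - of_bool (us ! p i = x))))"
    by (intro sum.cong refl arg_cong2[where f = "(*)"] prod.cong entry) auto
  also have "\<dots> = (\<Sum>p\<in>?P. \<Sum>f\<in>?F. (\<Prod>i = 0..<?m. ?c (us ! i) (f (us ! i))) *
      (signof p * (\<Prod>i = 0..<?m. functional_laplacian f (us ! i) (us ! p i))))"
    unfolding prod_sum_PiE_nth[OF us(1) fin] sum_distrib_left prod.distrib functional_laplacian_def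
    by (simp only: mult_ac)
  also have "\<dots> = (\<Sum>f\<in>?F. \<Sum>p\<in>?P. (\<Prod>i = 0..<?m. ?c (us ! i) (f (us ! i))) *
      (signof p * (\<Prod>i = 0..<?m. functional_laplacian f (us ! i) (us ! p i))))"
    by (rule sum.swap)
  also have "\<dots> = (\<Sum>f\<in>?F. (\<Prod>v\<in>set us. ?c v (f v)) *
      det (indexed_mat (functional_laplacian f) us))"
  proof (rule sum.cong[OF refl])
    fix f
    have "det (indexed_mat (functional_laplacian f) us) = (\<Sum>p\<in>?P. signof p *
      (\<Prod>i = 0..<?m. indexed_mat (functional_laplacian f) us $$ (i, p i)))"
      by (rule det_def') simp
    also have "\<dots> = (\<Sum>p\<in>?P. signof p * (\<Prod>i = 0..<?m. functional_laplacian f (us ! i) (us ! p i)))"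
      by (intro sum.cong refl arg_cong2[where f = "(*)"] prod.cong)
        (auto simp: indexed_mat_def perm)
    finally show "(\<Sum>p\<in>?P. (\<Prod>i = 0..<?m. ?c (us ! i) (f (us ! i))) *
      (signof p * (\<Prod>i = 0..<?m. functional_laplacian f (us ! i) (us ! p i)))) =
      (\<Prod>v\<in>set us. ?c v (f v)) * det (indexed_mat (functional_laplacian f) us)"
      by (simp only: sum_distrib_left prod_nth_distinct[OF us(1), of "\<lambda>v. ?c v (f v)"])
  qed
  also have "\<dots> = (\<Sum>f\<in>parent_functions H r. \<Prod>v\<in>?V - {r}. w {v, f v})"
  proof (rule sum.mono_neutral_cong_right)
    show "finite ?F" using fin by (intro finite_PiE) auto
    show "parent_functions H r \<subseteq> ?F"
      unfolding parent_functions_def us(2) by (rule Collect_restrict)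
    show "\<forall>f\<in>?F - parent_functions H r.
      (\<Prod>v\<in>set us. ?c v (f v)) * det (indexed_mat (functional_laplacian f) us) = 0"
    proof
      fix f assume f: "f \<in> ?F - parent_functions H r"
      show "(\<Prod>v\<in>set us. ?c v (f v)) * det (indexed_mat (functional_laplacian f) us) = 0"
      proof (cases "\<forall>v\<in>set us. {v, f v} \<in> edges H")
        case True
        then have "\<not> (\<forall>v\<in>?V. \<exists>k. (f ^^ k) v = r)"
          using f unfolding parent_functions_def us(2) by simp
        then obtain v where "v \<in> ?V" and v2: "\<And>k. (f ^^ k) v \<noteq> r" by blast
        then have v1: "v \<in> insert r (set us)" using V(1) by simp
        have "det (indexed_mat (functional_laplacian f) us) = 0"
          by (rule det_functional_laplacian_unrooted[OF us(1) _ V(2) v1 v2])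
            (use f in \<open>simp add: PiE_iff V(1)[symmetric]\<close>)
        then show ?thesis by simp
      next
        case False
        then have "(\<Prod>v\<in>set us. ?c v (f v)) = 0" by (intro prod_zero) auto
        then show ?thesis by simp
      qed
    qed
    fix f assume f: "f \<in> parent_functions H r"
    have "det (indexed_mat (functional_laplacian f) us) = 1"
      by (rule det_functional_laplacian_rooted[OF us(1) _ V(2)])
        (use f in \<open>simp add: parent_functions_def V(1)[symmetric]\<close>)
    moreover have "(\<Prod>v\<in>set us. ?c v (f v)) = (\<Prod>v\<in>?V - {r}. w {v, f v})"
      using parent_functionsD(2)[OF f] us by (intro prod.cong) auto
    ultimately show "(\<Prod>v\<in>set us. ?c v (f v)) * det (indexed_mat (functional_laplacian f) us) =
      (\<Prod>v\<in>?V - {r}. w {v, f v})" by simp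
  qed
  also have "\<dots> = (\<Sum>f\<in>parent_functions H r. \<Prod>e\<in>edges (parent_tree H r f). w e)"
    by (simp add: prod_parent_tree)
  also have "\<dots> = spanning_tree_enumerator H w"
    unfolding spanning_tree_enumerator_def
    by (rule sum.reindex_bij_betw[OF bij_betw_parent_tree[OF H r]])
  finally show ?thesis .
qed

section \<open>Pseudo-determinants as coefficients of the characteristic polynomial\<close>

text \<open>
  Over the complex numbers the characteristic polynomial is \<open>X\<^sup>k\<close> times a product of factors
  \<open>X - z\<close> over the non-zero eigenvalues, so its lowest non-vanishing coefficient is the product of
  the \<open>n - k\<close> numbers \<open>- z\<close>.
\<close>

lemma pseudo_det_eq_lowest_coeff:
  assumes M: "M \<in> carrier_mat n n"
    and low: "\<forall>j<k. coeff (char_poly M) j = 0" and ck: "coeff (char_poly M) k \<noteq> 0"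
  shows "pseudo_det M = complex_of_real ((-1) ^ (n - k) * coeff (char_poly M) k)"
proof -
  let ?M = "map_mat complex_of_real M"
  let ?p = "char_poly ?M"
  have M': "?M \<in> carrier_mat n n" using M by simp
  have p: "?p = map_poly complex_of_real (char_poly M)" by (rule of_real_hom.char_poly_hom[OF M])
  have coeff: "coeff ?p j = complex_of_real (coeff (char_poly M) j)" for j
    unfolding p by (simp add: coeff_map_poly)
  have deg: "degree ?p = n" and lead: "lead_coeff ?p = 1"
    using degree_monic_char_poly[OF M'] by auto
  then have p0: "?p \<noteq> 0" by auto
  have "monom 1 k dvd ?p" "\<not> monom 1 (Suc k) dvd ?p"
    using low ck by (auto simp: monom_1_dvd_iff' coeff)
  then have ord: "order 0 ?p = k" using p0 by (simp add: monom_1_dvd_iff)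
  let ?R = "{z. poly ?p z = 0}"
  \<comment> \<open>the factor of the characteristic polynomial that carries its non-zero roots\<close>
  define q where "q = (\<Prod>z\<in>?R - {0}. [:- z, 1:] ^ order z ?p)"
  have fin: "finite ?R" using p0 by (rule poly_roots_finite)
  have split: "?p = monom 1 k * q"
  proof -
    have "?p = (\<Prod>z\<in>?R. [:- z, 1:] ^ order z ?p)"
      using complex_poly_decompose[of ?p] lead by simp
    also have "\<dots> = [:0, 1:] ^ order 0 ?p * q"
    proof (cases "0 \<in> ?R")
      case True
      from prod.remove[OF fin this, of "\<lambda>z. [:- z, 1:] ^ order z ?p"] show ?thesis
        by (simp add: q_def)
    next
      case False
      then have "order 0 ?p = 0" by (simp add: order_0I)
      then show ?thesis using False by (simp add: q_def)
    qed
    finally show ?thesis by (simp add: ord monom_altdef)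
  qed
  have "degree q = (\<Sum>z\<in>?R - {0}. degree ([:- z, 1:] ^ order z ?p))"
    unfolding q_def by (rule degree_prod_eq_sum_degree) simp
  then have "degree q = (\<Sum>z\<in>?R - {0}. order z ?p)" by (simp add: degree_power_eq)
  moreover have "degree ?p = k + degree q"
  proof -
    have "q \<noteq> 0" using split p0 by auto
    then have "degree (monom 1 k * q) = k + degree q"
      by (simp add: degree_mult_eq degree_monom_eq)
    then show ?thesis using split by simp
  qed
  ultimately have degq: "(\<Sum>z\<in>?R - {0}. order z ?p) = n - k" using deg by simp
  have "coeff ?p k = coeff q 0" by (subst split) (simp add: coeff_monom_mult)
  also have "\<dots> = (\<Prod>z\<in>?R - {0}. (- z) ^ order z ?p)"
    by (simp add: q_def poly_0_coeff_0[symmetric] poly_prod)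
  also have "\<dots> = (\<Prod>z\<in>?R - {0}. (-1) ^ order z ?p * z ^ order z ?p)"
    by (intro prod.cong refl) (rule power_minus)
  also have "\<dots> = (-1) ^ (n - k) * (\<Prod>z\<in>?R - {0}. z ^ order z ?p)"
    by (simp only: prod.distrib power_sum[symmetric] degq)
  also have "?R - {0} = {z. eigenvalue ?M z \<and> z \<noteq> 0}"
    using eigenvalue_root_char_poly[OF M'] by auto
  also have "(\<Prod>z\<in>\<dots>. z ^ order z ?p) = pseudo_det M"
    by (simp add: pseudo_det_def Let_def)
  finally have "coeff ?p k = (-1) ^ (n - k) * pseudo_det M" .
  then have "(-1) ^ (n - k) * coeff ?p k = pseudo_det M"
    by (simp add: mult.assoc[symmetric] power_mult_distrib[symmetric])
  then show ?thesis by (simp add: coeff)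
qed

lemma coeff_0_char_poly:
  assumes "M \<in> carrier_mat n n"
  shows "coeff (char_poly M) 0 = (-1) ^ n * det (M :: 'a :: field mat)"
proof -
  have "coeff (char_poly M) 0 = det (- M)"
    using assms by (subst poly_0_coeff_0[symmetric], subst char_poly_matrix[OF assms])
      (auto intro!: arg_cong[where f = det] simp: char_matrix_def)
  also have "- M = (-1) \<cdot>\<^sub>m M" by auto
  finally show ?thesis using assms by simp
qed

text \<open>
  The linear coefficient is the constant coefficient of the derivative, and the derivative of
  the characteristic polynomial is the sum of the characteristic polynomials of the principal
  submatrices of size \<open>n - 1\<close>.
\<close>

lemma coeff_1_char_poly:
  assumes M: "M \<in> carrier_mat n n"
  shows "coeff (char_poly M) 1 = (-1) ^ (n - 1) * (\<Sum>i<n. det (mat_delete (M :: 'a :: field mat) i i))"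
proof -
  have "coeff (char_poly M) 1 = coeff (pderiv (char_poly M)) 0" by (simp add: coeff_pderiv)
  also have "\<dots> = (\<Sum>i<n. coeff (char_poly (mat_delete M i i)) 0)"
    unfolding pderiv_char_poly[OF M] by (simp add: coeff_sum)
  also have "\<dots> = (\<Sum>i<n. (-1) ^ (n - 1) * det (mat_delete M i i))"
    by (intro sum.cong refl coeff_0_char_poly mat_delete_carrier M)
  finally show ?thesis by (simp add: sum_distrib_left)
qed

lemma pseudo_det_nonsingular:
  assumes "M \<in> carrier_mat n n" "det M \<noteq> 0"
  shows "pseudo_det M = complex_of_real (det M)"
  using pseudo_det_eq_lowest_coeff[OF assms(1), of 0] assms(2)
  by (simp add: coeff_0_char_poly[OF assms(1)] power_mult_distrib[symmetric] mult.assoc[symmetric])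

lemma pseudo_det_corank_one:
  assumes M: "M \<in> carrier_mat n n" and "det M = 0" "(\<Sum>i<n. det (mat_delete M i i)) \<noteq> 0"
  shows "pseudo_det M = complex_of_real (\<Sum>i<n. det (mat_delete M i i))"
  using pseudo_det_eq_lowest_coeff[OF M, of 1] assms(2,3)
  by (simp add: coeff_0_char_poly[OF M] coeff_1_char_poly[OF M, simplified]
    power_mult_distrib[symmetric] mult.assoc[symmetric])

lemma mat_delete_indexed_mat:
  assumes "i < length vs"
  shows "mat_delete (indexed_mat K vs) i i = indexed_mat K (take i vs @ drop (Suc i) vs)"
  using assms by (intro eq_matI) (auto simp: mat_delete_def indexed_mat_def nth_append)

lemma det_weighted_laplacian:
  assumes H: "finite_simple_graph H" and vs: "distinct vs" "set vs = verts H" and ne: "vs \<noteq> []"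
  shows "det (indexed_mat (weighted_laplacian H w) vs) = 0"
proof -
  let ?n = "length vs" and ?L = "indexed_mat (weighted_laplacian H w) vs"
  let ?one = "vec ?n (\<lambda>_. 1 :: real)"
  have "?one $ 0 \<noteq> 0\<^sub>v ?n $ 0" using ne by simp
  then have nz: "?one \<noteq> 0\<^sub>v ?n" by metis
  have "?L *\<^sub>v ?one = 0\<^sub>v ?n"
  proof (rule eq_vecI)
    fix i assume "i < dim_vec (0\<^sub>v ?n :: real vec)"
    then have i: "i < ?n" by simp
    then have vi: "vs ! i \<in> verts H" unfolding vs(2)[symmetric] by (rule nth_mem)
    have "(?L *\<^sub>v ?one) $ i = (\<Sum>j = 0..<?n. weighted_laplacian H w (vs ! i) (vs ! j))"
      using i by (simp add: indexed_mat_def scalar_prod_def)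
    also have "\<dots> = (\<Sum>v\<in>verts H. weighted_laplacian H w (vs ! i) v)"
      using sum_nth_distinct[OF vs(1)] vs(2) by simp
    also have "\<dots> = 0" using weighted_laplacian_apply[OF H vi, of w "\<lambda>_. 1"] by simp
    finally show "(?L *\<^sub>v ?one) $ i = 0\<^sub>v ?n $ i" using i by simp
  qed simp
  then show ?thesis using nz
    by (subst det_0_iff_vec_prod_zero[of _ ?n]) (auto intro!: exI[of _ ?one])
qed

text \<open>
  Every principal minor of size one less counts the weighted spanning trees, by the matrix-tree
  theorem with the deleted vertex as root, and the sum of these minors is the
  pseudo-determinant. A non-zero enumerator ensures that 0 is a simple root of the characteristic
  polynomial.
\<close>

lemma pseudo_det_weighted_laplacian:
  assumes H: "finite_simple_graph H" and vs: "distinct vs" "set vs = verts H"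
    and nz: "spanning_tree_enumerator H w \<noteq> 0" and ne: "vs \<noteq> []"
  shows "pseudo_det (indexed_mat (weighted_laplacian H w) vs) =
    complex_of_real (real (card (verts H)) * spanning_tree_enumerator H w)"
proof -
  let ?n = "length vs" and ?L = "indexed_mat (weighted_laplacian H w) vs"
  have minor: "det (mat_delete ?L i i) = spanning_tree_enumerator H w" if i: "i < ?n" for i
  proof -
    let ?us = "take i vs @ drop (Suc i) vs"
    have vs_eq: "vs = take i vs @ vs ! i # drop (Suc i) vs" using i by (rule id_take_nth_drop)
    then have "distinct (take i vs @ vs ! i # drop (Suc i) vs)" using vs(1) by metis
    then have us: "distinct ?us" "vs ! i \<notin> set ?us" by auto
    have "set vs = set (take i vs @ vs ! i # drop (Suc i) vs)" using vs_eq by metis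
    then have "verts H = insert (vs ! i) (set ?us)" unfolding vs(2) by auto
    then have "set ?us = verts H - {vs ! i}" "vs ! i \<in> verts H" using us(2) by blast+
    then show ?thesis
      unfolding mat_delete_indexed_mat[OF i] using weighted_matrix_tree[OF H _ us(1)] by blast
  qed
  then have "(\<Sum>i<?n. det (mat_delete ?L i i)) = real (card (verts H)) * spanning_tree_enumerator H w"
    using distinct_card[OF vs(1)] vs(2) by simp
  moreover have "card (verts H) \<noteq> 0" using ne unfolding vs(2)[symmetric] by (simp add: card_eq_0_iff)
  ultimately show ?thesis
    using pseudo_det_corank_one[of ?L ?n] det_weighted_laplacian[OF H vs ne] nz by simp
qed

section \<open>Laplacians of connected graphs\<close>

lemma laplacian_eq_weighted_laplacian: "laplacian G = weighted_laplacian G (\<lambda>_. 1)"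
  by (intro ext) (simp add: laplacian_def degree_of_def weighted_laplacian_def)

lemma laplacian_matrix_eq_indexed_mat:
  "laplacian_matrix G vs = indexed_mat (weighted_laplacian G (\<lambda>_. 1)) vs"
  by (simp add: laplacian_block_def indexed_mat_def laplacian_eq_weighted_laplacian)

lemma spanning_tree_enumerator_unit_weight:
  "spanning_tree_enumerator G (\<lambda>_. 1) = real (num_spanning_trees G)"
  by (simp add: spanning_tree_enumerator_def num_spanning_trees_def)

text \<open>
  A function that vanishes off \<open>W\<close> and is harmonic on \<open>W\<close> has zero energy: the sum of
  \<open>X u * (L X) u\<close> over all vertices, which is zero term by term, is half the sum of
  \<open>(X u - X x)\<^sup>2\<close> over ordered adjacent pairs. Hence it is constant along edges, and zero since
  \<open>W\<close> omits a vertex.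
\<close>

lemma dirichlet_problem_unique:
  assumes G: "finite_simple_graph G" "connected_graph G" and W: "W \<subset> verts G"
    and bd: "\<And>v. v \<notin> W \<Longrightarrow> X v = 0"
    and harm: "\<And>u. u \<in> W \<Longrightarrow> (\<Sum>v\<in>verts G. laplacian G u v * X v) = 0"
    and v: "v \<in> verts G"
  shows "X v = 0"
proof -
  let ?V = "verts G"
  define E where "E u x = (edge_weight G (\<lambda>_. 1) u x :: real)" for u x
  have fin: "finite ?V" using G by (simp add: finite_simple_graph_def)
  have sym: "E u x = E x u" for u x by (simp add: E_def insert_commute)
  have zero: "(\<Sum>u\<in>?V. \<Sum>x\<in>?V. E u x * (X u * (X u - X x))) = 0"
  proof (rule sum.neutral, rule ballI)
    fix u assume u: "u \<in> ?V"
    have "(\<Sum>x\<in>?V. E u x * (X u * (X u - X x))) = X u * (\<Sum>x\<in>?V. E u x * (X u - X x))"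
      by (simp only: sum_distrib_left mult_ac)
    also have "\<dots> = X u * (\<Sum>v\<in>?V. laplacian G u v * X v)"
      using weighted_laplacian_apply[OF G(1) u, of "\<lambda>_. 1" X]
      by (simp only: laplacian_eq_weighted_laplacian E_def)
    also have "\<dots> = 0" using harm[of u] bd[of u] by (cases "u \<in> W") simp_all
    finally show "(\<Sum>x\<in>?V. E u x * (X u * (X u - X x))) = 0" .
  qed
  have "(\<Sum>u\<in>?V. \<Sum>x\<in>?V. E u x * (X x * (X x - X u))) =
      (\<Sum>x\<in>?V. \<Sum>u\<in>?V. E u x * (X x * (X x - X u)))" by (rule sum.swap)
  also have "\<dots> = (\<Sum>u\<in>?V. \<Sum>x\<in>?V. E u x * (X u * (X u - X x)))"
    by (intro sum.cong refl) (simp only: sym)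
  finally have zero': "(\<Sum>u\<in>?V. \<Sum>x\<in>?V. E u x * (X x * (X x - X u))) = 0" using zero by simp
  have "(\<Sum>u\<in>?V. \<Sum>x\<in>?V. E u x * (X u - X x)\<^sup>2) =
      (\<Sum>u\<in>?V. \<Sum>x\<in>?V. E u x * (X u * (X u - X x)) + E u x * (X x * (X x - X u)))"
    by (intro sum.cong refl) (simp add: power2_eq_square algebra_simps)
  also have "\<dots> = 0" using zero zero' by (simp only: sum.distrib add_0)
  finally have energy: "(\<Sum>u\<in>?V. \<Sum>x\<in>?V. E u x * (X u - X x)\<^sup>2) = 0" .
  have nonneg: "0 \<le> E u x * (X u - X x)\<^sup>2" for u x by (simp add: E_def)
  have adj: "X u = X x" if "{u, x} \<in> edges G" for u x
  proof -
    have ux: "u \<in> ?V" "x \<in> ?V" using finite_simple_edgeD[OF G(1) that] by auto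
    have "(\<Sum>x\<in>?V. E u x * (X u - X x)\<^sup>2) = 0"
      using energy ux fin by (subst (asm) sum_nonneg_eq_0_iff) (auto intro: sum_nonneg nonneg)
    then have "E u x * (X u - X x)\<^sup>2 = 0"
      using ux fin by (subst (asm) sum_nonneg_eq_0_iff) (auto intro: nonneg)
    then show ?thesis using that by (simp add: E_def)
  qed
  obtain b where b: "b \<in> ?V" "b \<notin> W" using W by blast
  have "(v, b) \<in> {(x, y). {x, y} \<in> edges G}\<^sup>*"
    using G(2) v b(1) unfolding connected_graph_def by blast
  then have "X v = X b" by (induction rule: rtrancl_induct) (auto dest: adj)
  then show ?thesis using bd[OF b(2)] by simp
qed

lemma det_laplacian_matrix_proper_nonzero:
  assumes G: "finite_simple_graph G" "connected_graph G"
    and us: "distinct us" "set us \<subset> verts G"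
  shows "det (laplacian_matrix G us) \<noteq> 0"
proof
  let ?n = "length us" and ?L = "laplacian_matrix G us"
  assume "det ?L = 0"
  then obtain x where x: "x \<in> carrier_vec ?n" "x \<noteq> 0\<^sub>v ?n" "?L *\<^sub>v x = 0\<^sub>v ?n"
    by (subst (asm) det_0_iff_vec_prod_zero[of _ ?n]) (auto simp: laplacian_block_def)
  obtain X where X: "\<And>i. i < ?n \<Longrightarrow> X (us ! i) = x $ i" "\<And>v. v \<notin> set us \<Longrightarrow> X v = 0"
    using distinct_nth_extend[OF us(1), of "\<lambda>i. x $ i" 0] by blast
  have fin: "finite (verts G)" using G by (simp add: finite_simple_graph_def)
  have "(\<Sum>v\<in>verts G. laplacian G u v * X v) = 0" if u: "u \<in> set us" for u
  proof -
    obtain i where i: "i < ?n" "us ! i = u" using u by (auto simp: in_set_conv_nth)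
    have "(\<Sum>v\<in>verts G. laplacian G u v * X v) = (\<Sum>v\<in>set us. laplacian G u v * X v)"
      using fin us(2) X(2) by (intro sum.mono_neutral_right) auto
    also have "\<dots> = (\<Sum>j = 0..<?n. laplacian G u (us ! j) * X (us ! j))"
      by (rule sum_nth_distinct[OF us(1), symmetric])
    also have "\<dots> = (?L *\<^sub>v x) $ i"
      using i x(1) by (simp add: laplacian_block_def scalar_prod_def X(1))
    finally show ?thesis using x(3) i by simp
  qed
  then have "X v = 0" if "v \<in> verts G" for v
    using dirichlet_problem_unique[OF G us(2), of X v] X(2) that by blast
  then have "x $ i = 0" if "i < ?n" for i
    using X(1)[OF that] us(2) that by (metis nth_mem psubset_imp_subset subsetD)
  then have "x = 0\<^sub>v ?n" using x(1) by (intro eq_vecI) auto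
  then show False using x(2) by simp
qed

section \<open>Schur complements\<close>

lemma mat_inverse_nonsingular:
  assumes A: "A \<in> carrier_mat n n" and "det A \<noteq> (0 :: 'a :: field)"
  obtains A' where "mat_inverse A = Some A'" "A' \<in> carrier_mat n n" "A * A' = 1\<^sub>m n" "A' * A = 1\<^sub>m n"
proof (cases "mat_inverse A")
  case None
  have "A \<notin> Units (ring_mat TYPE('a) n ())" by (rule mat_inverse(1)[OF A None])
  from this det_non_zero_imp_unit[OF assms] show thesis by (rule notE)
next
  case (Some A')
  then show thesis using mat_inverse(2)[OF A Some] that by blast
qed

lemma schur_complement_carrier:
  assumes "B \<in> carrier_mat n m" "D \<in> carrier_mat m m"
  shows "schur_complement A B D \<in> carrier_mat m m"
  using assms by (auto simp: schur_complement_def)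

text \<open>
  Block elimination: the block matrix is a unit lower triangular block matrix times one that is
  upper triangular with diagonal blocks \<open>A\<close> and the Schur complement.
\<close>

lemma det_schur_complement:
  assumes A: "A \<in> carrier_mat n n" and B: "B \<in> carrier_mat n m" and D: "D \<in> carrier_mat m m"
    and dA: "det A \<noteq> 0"
  shows "det (four_block_mat A B (transpose_mat B) D) = det A * det (schur_complement A B D)"
proof -
  obtain A' where A': "mat_inverse A = Some A'" "A' \<in> carrier_mat n n" "A' * A = 1\<^sub>m n"
    by (rule mat_inverse_nonsingular[OF A dA])
  let ?S = "schur_complement A B D" and ?C = "transpose_mat B"
  have S: "?S \<in> carrier_mat m m" by (rule schur_complement_carrier[OF B D])
  have C: "?C \<in> carrier_mat m n" using B by simp
  have CA: "?C * A' \<in> carrier_mat m n" using C A' by simp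
  have e1: "?C * A' * A = ?C" using assoc_mult_mat[OF C A'(2) A] A'(3) C by simp
  have e2: "?C * A' * B + ?S = D"
    using CA B D by (intro eq_matI) (auto simp: schur_complement_def A'(1))
  have "four_block_mat A B ?C D =
    four_block_mat (1\<^sub>m n) (0\<^sub>m n m) (?C * A') (1\<^sub>m m) * four_block_mat A B (0\<^sub>m m n) ?S"
    using A B C S CA e1 e2
    by (subst mult_four_block_mat[OF one_carrier_mat zero_carrier_mat CA one_carrier_mat A B
          zero_carrier_mat S]) simp
  also have "det \<dots> = det (four_block_mat (1\<^sub>m n) (0\<^sub>m n m) (?C * A') (1\<^sub>m m)) *
      det (four_block_mat A B (0\<^sub>m m n) ?S)"
    using A S by (intro det_mult[of _ "n + m"]) auto
  also have "\<dots> = det A * det ?S"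
    using det_four_block_mat_upper_right_zero[OF one_carrier_mat refl CA one_carrier_mat]
      det_four_block_mat_lower_left_zero[OF A B refl S] by simp
  finally show ?thesis .
qed

text \<open>
  The inverse of a symmetric matrix is symmetric.
\<close>

lemma schur_complement_symmetric:
  assumes A: "A \<in> carrier_mat n n" and B: "B \<in> carrier_mat n m" and D: "D \<in> carrier_mat m m"
    and dA: "det A \<noteq> 0" and sym: "transpose_mat A = A" "transpose_mat D = D"
  shows "transpose_mat (schur_complement A B D) = schur_complement A B D"
proof -
  obtain A' where A': "mat_inverse A = Some A'" "A' \<in> carrier_mat n n" "A * A' = 1\<^sub>m n"
    by (rule mat_inverse_nonsingular[OF A dA])
  let ?C = "transpose_mat B"
  have C: "?C \<in> carrier_mat m n" using B by simp
  have T: "transpose_mat A' \<in> carrier_mat n n" using A' by simp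
  have "transpose_mat A' * A = transpose_mat (A * A')"
    using transpose_mult[OF A A'(2)] sym by simp
  then have TA: "transpose_mat A' * A = 1\<^sub>m n" using A'(3) by simp
  have "transpose_mat A' = transpose_mat A' * (A * A')" using A'(3) T by simp
  also have "\<dots> = A'" using assoc_mult_mat[OF T A A'(2)] TA A'(2) by simp
  finally have symA': "transpose_mat A' = A'" .
  have "transpose_mat (?C * A' * B) = ?C * (A' * B)"
    using transpose_mult[OF mult_carrier_mat[OF C A'(2)] B] transpose_mult[OF C A'(2)] symA' by simp
  then have "transpose_mat (?C * A' * B) = ?C * A' * B" using assoc_mult_mat[OF C A'(2) B] by simp
  moreover have "?C * A' * B \<in> carrier_mat m m" using C A' B by simp
  ultimately show ?thesis
    using D sym by (simp add: schur_complement_def A'(1) transpose_minus)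
qed

text \<open>
  The Schur complement describes the lower block of the system once \<open>x\<close> has been eliminated by
  means of the upper block. Applied to constant vectors, it turns vanishing row sums of a Laplacian
  into vanishing row sums of its Schur complement.
\<close>

lemma schur_complement_mult_vec:
  assumes A: "A \<in> carrier_mat n n" and B: "B \<in> carrier_mat n m" and D: "D \<in> carrier_mat m m"
    and dA: "det A \<noteq> 0" and x: "x \<in> carrier_vec n" and y: "y \<in> carrier_vec m"
    and eq: "A *\<^sub>v x + B *\<^sub>v y = 0\<^sub>v n"
  shows "schur_complement A B D *\<^sub>v y = transpose_mat B *\<^sub>v x + D *\<^sub>v y"
proof -
  obtain A' where A': "mat_inverse A = Some A'" "A' \<in> carrier_mat n n" "A' * A = 1\<^sub>m n"
    by (rule mat_inverse_nonsingular[OF A dA])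
  let ?C = "transpose_mat B"
  have C: "?C \<in> carrier_mat m n" using B by simp
  have Ax: "A *\<^sub>v x \<in> carrier_vec n" and By: "B *\<^sub>v y \<in> carrier_vec n" using A B x y by auto
  have "A' *\<^sub>v (A *\<^sub>v x) + A' *\<^sub>v (B *\<^sub>v y) = A' *\<^sub>v (A *\<^sub>v x + B *\<^sub>v y)"
    using mult_add_distrib_mat_vec[OF A'(2) Ax By] by simp
  also have "\<dots> = 0\<^sub>v n" unfolding eq using A'(2) by (intro eq_vecI) auto
  also have "A' *\<^sub>v (A *\<^sub>v x) = x" using assoc_mult_mat_vec[OF A'(2) A x] A'(3) x by simp
  finally have sum: "x + A' *\<^sub>v (B *\<^sub>v y) = 0\<^sub>v n" .
  have A'By: "A' *\<^sub>v (B *\<^sub>v y) \<in> carrier_vec n" using A' By by simp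
  have "(A' *\<^sub>v (B *\<^sub>v y)) $ i = - x $ i" if "i < n" for i
  proof -
    have "(x + A' *\<^sub>v (B *\<^sub>v y)) $ i = 0" using sum that by simp
    moreover have "(x + A' *\<^sub>v (B *\<^sub>v y)) $ i = x $ i + (A' *\<^sub>v (B *\<^sub>v y)) $ i"
      using A'(2) that by (intro index_add_vec(1)) simp
    ultimately show ?thesis by (simp add: add_eq_0_iff)
  qed
  then have x_eq: "A' *\<^sub>v (B *\<^sub>v y) = - x"
    using x A'(2) by (intro eq_vecI) simp_all
  have "schur_complement A B D *\<^sub>v y = D *\<^sub>v y - ?C * A' * B *\<^sub>v y"
    using C A' B D y by (simp add: schur_complement_def A'(1) minus_mult_distrib_mat_vec)
  also have "?C * A' * B *\<^sub>v y = ?C *\<^sub>v (A' *\<^sub>v (B *\<^sub>v y))"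
    using assoc_mult_mat_vec[OF mult_carrier_mat[OF C A'(2)] B y] assoc_mult_mat_vec[OF C A'(2) By]
    by simp
  also have "\<dots> = - (?C *\<^sub>v x)" unfolding x_eq
    using C x by (intro eq_vecI) auto
  finally show ?thesis using C D x y by (intro eq_vecI) auto
qed

text \<open>
  Deleting a vertex of the block \<open>D\<close> commutes with the Schur complement, because only \<open>A\<close> is
  inverted. This transfers a reduced determinant of the large matrix to one of the Schur
  complement.
\<close>

lemma schur_complement_truncate:
  assumes A: "A \<in> carrier_mat n n" and B: "B \<in> carrier_mat n m" and D: "D \<in> carrier_mat m m"
    and dA: "det A \<noteq> 0" and k: "k \<le> m"
  shows "schur_complement A (mat n k (($$) B)) (mat k k (($$) D)) =
    mat k k (($$) (schur_complement A B D))"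
proof -
  obtain A' where A': "mat_inverse A = Some A'" "A' \<in> carrier_mat n n"
    by (rule mat_inverse_nonsingular[OF A dA])
  show ?thesis
    using A' B D k
    by (intro eq_matI) (auto simp: schur_complement_def scalar_prod_def simp del: assoc_mult_mat)
qed

section \<open>The Schur complement graph\<close>

lemma finite_simple_schur_graph:
  assumes "distinct ws"
  shows "finite_simple_graph (schur_graph ws S)"
  using assms unfolding finite_simple_graph_def schur_graph_def
  by (auto simp: nth_eq_iff_index_eq) (metis nth_eq_iff_index_eq nth_mem)

lemma indices_of_doubleton:
  assumes "distinct ws" "i < length ws" "j < length ws" "k < length ws" "l < length ws"
    and "{ws ! i, ws ! j} = {ws ! k, ws ! l}"
  shows "i = k \<and> j = l \<or> i = l \<and> j = k"
  using assms by (auto simp: doubleton_eq_iff nth_eq_iff_index_eq)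

text \<open>
  Off the diagonal this holds by the choice of edges and weights; on the diagonal it expresses
  that the rows of \<open>S\<close> sum to zero.
\<close>

lemma weighted_laplacian_schur_graph:
  assumes ws: "distinct ws" and S: "S \<in> carrier_mat (length ws) (length ws)"
    and sym: "transpose_mat S = S" and row: "S *\<^sub>v vec (length ws) (\<lambda>_. 1) = 0\<^sub>v (length ws)"
  shows "indexed_mat (weighted_laplacian (schur_graph ws S) (schur_weight ws S)) ws = S"
proof (rule eq_matI)
  let ?m = "length ws" and ?H = "schur_graph ws S" and ?w = "schur_weight ws S"
  let ?L = "indexed_mat (weighted_laplacian ?H ?w) ws"
  have sym: "S $$ (j, i) = S $$ (i, j)" if "i < ?m" "j < ?m" for i j
    using that S arg_cong[OF sym, of "\<lambda>M. M $$ (i, j)"] by simp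
  have edge: "{ws ! i, ws ! j} \<in> edges ?H \<longleftrightarrow> i \<noteq> j \<and> S $$ (i, j) \<noteq> 0"
    if ij: "i < ?m" "j < ?m" for i j
  proof
    assume "{ws ! i, ws ! j} \<in> edges ?H"
    then obtain k l where kl: "k < ?m" "l < ?m" "k \<noteq> l" "S $$ (k, l) \<noteq> 0"
      "{ws ! i, ws ! j} = {ws ! k, ws ! l}" by (auto simp: schur_graph_def)
    then show "i \<noteq> j \<and> S $$ (i, j) \<noteq> 0"
      using indices_of_doubleton[OF ws ij kl(1,2,5)] sym by auto
  qed (use ij in \<open>auto simp: schur_graph_def\<close>)
  have weight: "?w {ws ! i, ws ! j} = - S $$ (i, j)" if ij: "i < ?m" "j < ?m" "i \<noteq> j" for i j
    unfolding schur_weight_def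
  proof (rule the_equality)
    fix x assume "\<exists>k l. k < ?m \<and> l < ?m \<and> k \<noteq> l \<and> {ws ! i, ws ! j} = {ws ! k, ws ! l} \<and>
      x = - S $$ (k, l)"
    then obtain k l where kl: "k < ?m" "l < ?m" "{ws ! i, ws ! j} = {ws ! k, ws ! l}"
      "x = - S $$ (k, l)" by blast
    then show "x = - S $$ (i, j)" using indices_of_doubleton[OF ws ij(1,2) kl(1-3)] sym by auto
  qed (use ij in blast)
  show "dim_row ?L = dim_row S" "dim_col ?L = dim_col S" using S by auto
  fix i j assume "i < dim_row S" "j < dim_col S"
  then have ij: "i < ?m" "j < ?m" using S by auto
  show "?L $$ (i, j) = S $$ (i, j)"
  proof (cases "i = j")
    case False
    then show ?thesis using ij ws edge[OF ij] weight[OF ij]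
      by (simp add: indexed_mat_def weighted_laplacian_def nth_eq_iff_index_eq)
  next
    case True
    have fin: "finite (verts ?H)" and V: "verts ?H = set ws" by (simp_all add: schur_graph_def)
    have "?L $$ (i, i) = (\<Sum>x\<in>set ws. edge_weight ?H ?w (ws ! i) x)"
      using ij(1) fin by (simp add: indexed_mat_def weighted_laplacian_def sum.inter_filter V)
    also have "\<dots> = (\<Sum>k = 0..<?m. edge_weight ?H ?w (ws ! i) (ws ! k))"
      by (rule sum_nth_distinct[OF ws, symmetric])
    also have "\<dots> = (\<Sum>k = 0..<?m. (if k = i then S $$ (i, i) else 0) - S $$ (i, k))"
    proof (rule sum.cong[OF refl])
      fix k assume k: "k \<in> {0..<?m}"
      show "edge_weight ?H ?w (ws ! i) (ws ! k) = (if k = i then S $$ (i, i) else 0) - S $$ (i, k)"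
        using edge[OF ij(1), of k] weight[OF ij(1), of k] k by auto
    qed
    also have "\<dots> = S $$ (i, i) - (\<Sum>k = 0..<?m. S $$ (i, k))" using ij by (simp add: sum_subtractf)
    also have "(\<Sum>k = 0..<?m. S $$ (i, k)) = (S *\<^sub>v vec ?m (\<lambda>_. 1)) $ i"
      using S ij by (simp add: scalar_prod_def)
    also have "\<dots> = 0" using row ij by simp
    finally show ?thesis using True by simp
  qed
qed

text \<open>
  The blocks are determined by their sizes; in particular the Schur complement of \<open>A\<close>, \<open>B\<close>, \<open>D\<close>
  is the Dirichlet-to-Neumann map.
\<close>

lemma laplacian_blocks:
  assumes blocks: "A \<in> carrier_mat (length us) (length us)"
      "B \<in> carrier_mat (length us) (length ws)"
      "D \<in> carrier_mat (length ws) (length ws)"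
      "laplacian_matrix G (us @ ws) = four_block_mat A B (transpose_mat B) D"
  shows "A = laplacian_matrix G us" "B = laplacian_block G us ws" "D = laplacian_matrix G ws"
proof -
  let ?n = "length us" and ?m = "length ws"
  have entry: "four_block_mat A B (transpose_mat B) D $$ (i, j) =
      laplacian G ((us @ ws) ! i) ((us @ ws) ! j)" if "i < ?n + ?m" "j < ?n + ?m" for i j
    using that by (simp add: laplacian_block_def flip: blocks(4))
  have "A $$ (i, j) = laplacian G (us ! i) (us ! j)" if "i < ?n" "j < ?n" for i j
    using entry[of i j] that blocks(1-3) by (simp add: nth_append)
  then show "A = laplacian_matrix G us"
    using blocks(1) by (intro eq_matI) (auto simp: laplacian_block_def)
  have "B $$ (i, j) = laplacian G (us ! i) (ws ! j)" if "i < ?n" "j < ?m" for i j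
    using entry[of i "?n + j"] that blocks(1-3) by (simp add: nth_append)
  then show "B = laplacian_block G us ws"
    using blocks(2) by (intro eq_matI) (auto simp: laplacian_block_def)
  have "D $$ (i, j) = laplacian G (ws ! i) (ws ! j)" if "i < ?m" "j < ?m" for i j
    using entry[of "?n + i" "?n + j"] that blocks(1-3) by (simp add: nth_append)
  then show "D = laplacian_matrix G ws"
    using blocks(3) by (intro eq_matI) (auto simp: laplacian_block_def)
qed

text \<open>
  Delete from the Laplacian of \<open>G\<close> the row and column of the last vertex of \<open>ws\<close>. The
  matrix-tree theorem for \<open>G\<close> evaluates the remaining determinant as the number of spanning
  trees. Block elimination of \<open>A\<close> evaluates it as \<open>det A\<close> times a reduced determinant of \<open>S\<close>,
  and the matrix-tree theorem for the Schur complement graph identifies the latter. As the reduced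
  Laplacian of a connected graph is invertible, the common value is not zero.
\<close>

lemma spanning_trees_schur_complement:
  assumes G: "finite_simple_graph G" "connected_graph G"
    and us: "distinct us" "set us = verts G - set ws"
    and ws: "distinct ws" "set ws \<subseteq> verts G" "ws \<noteq> []"
    and blocks: "A \<in> carrier_mat (length us) (length us)"
      "B \<in> carrier_mat (length us) (length ws)"
      "D \<in> carrier_mat (length ws) (length ws)"
      "laplacian_matrix G (us @ ws) = four_block_mat A B (transpose_mat B) D"
    and S: "S = schur_complement A B D"
  shows "det A \<noteq> 0"
    and "indexed_mat (weighted_laplacian (schur_graph ws S) (schur_weight ws S)) ws = S" (is ?lap)
    and "real (num_spanning_trees G) =
      det A * spanning_tree_enumerator (schur_graph ws S) (schur_weight ws S)"
    and "num_spanning_trees G \<noteq> 0"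
proof -
  let ?n = "length us" and ?m = "length ws"
  let ?H = "schur_graph ws S" and ?w = "schur_weight ws S"
  have lap_sym: "laplacian G u v = laplacian G v u" for u v
    by (auto simp: laplacian_def insert_commute)
  note eqs = laplacian_blocks[OF blocks]
  have Aij: "A $$ (i, j) = laplacian G (us ! i) (us ! j)" if "i < ?n" "j < ?n" for i j
    unfolding eqs(1) using that by (simp add: laplacian_block_def)
  have Bij: "B $$ (i, j) = laplacian G (us ! i) (ws ! j)" if "i < ?n" "j < ?m" for i j
    unfolding eqs(2) using that by (simp add: laplacian_block_def)
  have Dij: "D $$ (i, j) = laplacian G (ws ! i) (ws ! j)" if "i < ?m" "j < ?m" for i j
    unfolding eqs(3) using that by (simp add: laplacian_block_def)
  have disj: "set us \<inter> set ws = {}" and V: "verts G = set us \<union> set ws" using us ws by auto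
  have "set us \<subset> verts G" using ws us by (cases ws) auto
  then show dA: "det A \<noteq> 0" unfolding eqs(1) by (rule det_laplacian_matrix_proper_nonzero[OF G us(1)])
  have Scar: "S \<in> carrier_mat ?m ?m" unfolding S by (rule schur_complement_carrier[OF blocks(2,3)])
  have "transpose_mat A = A" "transpose_mat D = D"
    using blocks(1,3) Aij Dij lap_sym by (auto intro!: eq_matI)
  then have Ssym: "transpose_mat S = S"
    unfolding S by (rule schur_complement_symmetric[OF blocks(1-3) dA])
  have row_sum: "(\<Sum>j = 0..<?n. laplacian G u (us ! j)) + (\<Sum>j = 0..<?m. laplacian G u (ws ! j)) = 0"
    if u: "u \<in> verts G" for u
  proof -
    have "(\<Sum>v\<in>verts G. laplacian G u v) = 0"
      using weighted_laplacian_apply[OF G(1) u, of "\<lambda>_. 1" "\<lambda>_. 1"]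
      by (simp add: laplacian_eq_weighted_laplacian)
    then show ?thesis
      unfolding sum_nth_distinct[OF us(1)] sum_nth_distinct[OF ws(1)] V
      using disj by (simp add: sum.union_disjoint)
  qed
  let ?one = "\<lambda>k. vec k (\<lambda>_. 1 :: real)"
  have "A *\<^sub>v ?one ?n + B *\<^sub>v ?one ?m = 0\<^sub>v ?n"
    using blocks(1,2) V row_sum by (intro eq_vecI) (auto simp: scalar_prod_def Aij Bij)
  then have "S *\<^sub>v ?one ?m = transpose_mat B *\<^sub>v ?one ?n + D *\<^sub>v ?one ?m"
    unfolding S by (intro schur_complement_mult_vec[OF blocks(1-3) dA]) auto
  also have "\<dots> = 0\<^sub>v ?m"
  proof (rule eq_vecI)
    fix i assume "i < dim_vec (0\<^sub>v ?m :: real vec)"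
    then have i: "i < ?m" by simp
    have "(transpose_mat B *\<^sub>v ?one ?n + D *\<^sub>v ?one ?m) $ i =
      (\<Sum>j = 0..<?n. laplacian G (us ! j) (ws ! i)) + (\<Sum>j = 0..<?m. laplacian G (ws ! i) (ws ! j))"
      using blocks(2,3) i by (simp add: scalar_prod_def Bij Dij)
    also have "\<dots> = 0" using row_sum[of "ws ! i"] i ws(2) lap_sym by (simp add: subset_iff)
    finally show "(transpose_mat B *\<^sub>v ?one ?n + D *\<^sub>v ?one ?m) $ i = 0\<^sub>v ?m $ i" using i by simp
  qed (use blocks in simp)
  finally show lap: ?lap by (intro weighted_laplacian_schur_graph ws(1) Scar Ssym)
  define k ws' r where "k = ?m - 1" "ws' = butlast ws" "r = last ws"
  have ws_eq: "ws = ws' @ [r]" and k: "length ws' = k" "?m = Suc k"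
    using ws(3) by (simp_all add: k_ws'_r_def)
  have ws': "distinct ws'" "r \<notin> set ws'" "set ws = insert r (set ws')"
    using ws(1) unfolding ws_eq by auto
  have r: "r \<in> verts G" "r \<notin> set us" using ws' ws(2) us(2) by auto
  have us_ws': "distinct (us @ ws')" "set (us @ ws') = verts G - {r}"
    using us(1) ws' disj V r by auto
  \<comment> \<open>the blocks of the Laplacian from which \<open>r\<close> has been deleted\<close>
  let ?B = "mat ?n k (($$) B)" and ?D = "mat k k (($$) D)"
  have "laplacian_matrix G (us @ ws') = four_block_mat A ?B (transpose_mat ?B) ?D"
    using blocks(1) k ws_eq lap_sym
    by (intro eq_matI) (auto simp: laplacian_block_def nth_append Aij Bij Dij)
  then have "det (laplacian_matrix G (us @ ws')) = det A * det (schur_complement A ?B ?D)"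
    using det_schur_complement[OF blocks(1), of ?B k ?D] dA by simp
  also have "schur_complement A ?B ?D = mat k k (($$) S)"
    unfolding S by (rule schur_complement_truncate[OF blocks(1-3) dA]) (simp add: k)
  also have "\<dots> = mat k k (($$) (indexed_mat (weighted_laplacian ?H ?w) ws))" by (simp only: lap)
  also have "\<dots> = indexed_mat (weighted_laplacian ?H ?w) ws'"
    by (intro eq_matI) (auto simp: indexed_mat_def k ws_eq nth_append)
  also have "det \<dots> = spanning_tree_enumerator ?H ?w"
    by (rule weighted_matrix_tree[OF finite_simple_schur_graph[OF ws(1)] _ ws'(1), of r])
      (use ws' in \<open>auto simp: schur_graph_def\<close>)
  finally have det: "det (laplacian_matrix G (us @ ws')) = det A * spanning_tree_enumerator ?H ?w" .
  have tau: "det (laplacian_matrix G (us @ ws')) = real (num_spanning_trees G)"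
    unfolding laplacian_matrix_eq_indexed_mat weighted_matrix_tree[OF G(1) r(1) us_ws']
    by (rule spanning_tree_enumerator_unit_weight)
  show "real (num_spanning_trees G) = det A * spanning_tree_enumerator ?H ?w"
    using det tau by simp
  have "set (us @ ws') \<subset> verts G" unfolding us_ws'(2) using r(1) by blast
  then have "real (num_spanning_trees G) \<noteq> 0"
    using det_laplacian_matrix_proper_nonzero[OF G us_ws'(1)] tau by simp
  then show "num_spanning_trees G \<noteq> 0" by simp
qed

theorem corollary3p1:
  fixes G Y :: "'a graph" and us ws :: "'a list" and A B D S :: "real mat"
  assumes G: "finite_simple_graph G" "connected_graph G"
    and Y: "full_subgraph Y G" "verts Y \<noteq> {}"
    and us: "distinct us" "set us = verts G - verts Y"
    and ws: "distinct ws" "set ws = verts Y"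
    and blocks: "A \<in> carrier_mat (length us) (length us)"
      "B \<in> carrier_mat (length us) (length ws)"
      "D \<in> carrier_mat (length ws) (length ws)"
      "laplacian_matrix G (us @ ws) = four_block_mat A B (transpose_mat B) D"
    and S: "S = schur_complement A B D"
  shows "complex_of_real (real (num_spanning_trees G)) =
           pseudo_det A *
           complex_of_real (spanning_tree_enumerator (schur_graph ws S) (schur_weight ws S))
     \<longleftrightarrow>
         pseudo_det (laplacian_matrix G (us @ ws)) =
           complex_of_real (real (card (verts G)) / real (card (verts Y)) * det A) *
           pseudo_det (dirichlet_to_neumann G us ws)"
proof -
  let ?H = "schur_graph ws S" and ?w = "schur_weight ws S"
  have YV: "verts Y \<subseteq> verts G" using Y(1) by (simp add: full_subgraph_def is_subgraph_def)
  have us': "set us = verts G - set ws" and ws': "set ws \<subseteq> verts G" "ws \<noteq> []"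
    using us(2) ws(2) YV Y(2) by auto
  note main = spanning_trees_schur_complement[OF G us(1) us' ws(1) ws' blocks S]
  have tau: "real (num_spanning_trees G) = det A * spanning_tree_enumerator ?H ?w" by (rule main(3))
  then have tau_nz: "spanning_tree_enumerator ?H ?w \<noteq> 0" using main(4) by auto
  have pA: "pseudo_det A = complex_of_real (det A)"
    by (rule pseudo_det_nonsingular[OF blocks(1) main(1)])
  have us_ws: "distinct (us @ ws)" "set (us @ ws) = verts G" "us @ ws \<noteq> []"
    using us(1) ws(1) us' ws' by auto
  have pL: "pseudo_det (laplacian_matrix G (us @ ws)) =
      complex_of_real (real (card (verts G)) * real (num_spanning_trees G))"
    unfolding laplacian_matrix_eq_indexed_mat
    using pseudo_det_weighted_laplacian[OF G(1) us_ws(1,2) _ us_ws(3), of "\<lambda>_. 1"] main(4)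
    by (simp add: spanning_tree_enumerator_unit_weight)
  have "dirichlet_to_neumann G us ws = S"
    unfolding dirichlet_to_neumann_def S laplacian_blocks[OF blocks, symmetric] by (rule refl)
  moreover have "pseudo_det S =
      complex_of_real (real (card (verts Y)) * spanning_tree_enumerator ?H ?w)"
    using pseudo_det_weighted_laplacian[OF finite_simple_schur_graph[OF ws(1)] ws(1) _ tau_nz ws'(2)]
    unfolding main(2) by (simp add: schur_graph_def ws(2))
  ultimately have pS: "pseudo_det (dirichlet_to_neumann G us ws) =
      complex_of_real (real (card (verts Y)) * spanning_tree_enumerator ?H ?w)" by simp
  have "card (verts Y) \<noteq> 0" using Y(2) unfolding ws(2)[symmetric] by (simp add: card_eq_0_iff)
  then show ?thesis unfolding pA pL pS tau
    by (simp add: field_simps)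
qed

end
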